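(* Let $N\ge 1$ and let $(A_k)_{1\le k\le N}$ be events on a probability space $(\Omega,\mathcal F,\mathbb P)$, with the coefficient $\varphi(\cdot)$ fixed by one of the two conventions (ambient: $\varphi=\varphi_A$; or finite restricted: $\varphi=\varphi_N$). Then for each integer $L\ge 0$, $$\mathbb P\Bigl(\bigcup_{k=1}^{N}A_k\Bigr)\ \ge\ 1-\exp\Bigl(-\frac{1}{L+1}\sum_{k=1}^{N}\bigl(\mathbb P(A_k)-\varphi(L+1)\bigr)_{+}\Bigr).$$ In particular, if $\varphi(L+1)\le \min_{1\le k\le N}\mathbb P(A_k)$, then $$\mathbb P\Bigl(\bigcup_{k=1}^{N}A_k\Bigr)\ \ge\ 1-\exp\Bigl(-\frac{1}{L+1}\bigl(S_N-N\varphi(L+1)\bigr)\Bigr).$$ The statement holds under each of the two conventions.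
   Context: Notation: $(x)_+=\max(x,0)$ and $S_N=\sum_{k=1}^N\mathbb P(A_k)$. For sub-$\sigma$-algebras $\mathcal A,\mathcal B\subseteq\mathcal F$, $\varphi(\mathcal A,\mathcal B)=\sup\{|\mathbb P(B\mid A)-\mathbb P(B)|: A\in\mathcal A,\ \mathbb P(A)>0,\ B\in\mathcal B\}$. For integers $a,b\ge1$, $\mathcal F_a^b=\sigma(A_j: a\le j\le b)$ (trivial if $a>b$) and $\mathcal F_a^\infty=\sigma(A_j: j\ge a)$. Ambient convention: the events are the first $N$ members of a sequence $(A_k)_{k\ge1}$, and $\varphi(n)=\varphi_A(n):=\sup_{k\ge1}\varphi(\mathcal F_1^k,\mathcal F_{k+n}^\infty)$. Finite restricted convention: $\varphi(n)=\varphi_N(n):=\sup_{1\le k\le N}\varphi(\mathcal F_1^k,\mathcal F_{k+n}^N)$, where $\mathcal F_a^N$ is trivial when $a>N$. *)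

theory Defs
  imports "HOL-Probability.Probability"
begin

(* Sub-sigma-algebras of sets M are represented by their families of events. For such families
   and a probability measure M, the sets of reals under the suprema below are nonempty and bounded
   by 1, so that the real-valued Sup and SUP are genuine suprema. *)
definition phi_mix :: "'a measure \<Rightarrow> 'a set set \<Rightarrow> 'a set set \<Rightarrow> real" where
  "phi_mix M \<A> \<B> =
     Sup {\<bar>cond_prob M (\<lambda>\<omega>. \<omega> \<in> B) (\<lambda>\<omega>. \<omega> \<in> A) - measure M B\<bar> | A B.
            A \<in> \<A> \<and> measure M A > 0 \<and> B \<in> \<B>}"

(* The index set I is {a..b} or {a..}; for an empty I this is the trivial sigma-algebra. *)
definition events_sigma :: "'a measure \<Rightarrow> (nat \<Rightarrow> 'a set) \<Rightarrow> nat set \<Rightarrow> 'a set set" where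
  "events_sigma M A I = sigma_sets (space M) (A ` I)"

(* Events are indexed from 1; the value A 0 is never used. *)
definition phi_ambient :: "'a measure \<Rightarrow> (nat \<Rightarrow> 'a set) \<Rightarrow> nat \<Rightarrow> real" where
  "phi_ambient M A n =
     (SUP k\<in>{1..}. phi_mix M (events_sigma M A {1..k}) (events_sigma M A {k + n..}))"

definition phi_restricted :: "'a measure \<Rightarrow> (nat \<Rightarrow> 'a set) \<Rightarrow> nat \<Rightarrow> nat \<Rightarrow> real" where
  "phi_restricted M A N n =
     (SUP k\<in>{1..N}. phi_mix M (events_sigma M A {1..k}) (events_sigma M A {k + n..N}))"

end

theory Submission
  imports Defs
begin

text \<open>
  One of the \<open>L + 1\<close> residue classes modulo \<open>L + 1\<close> carries at least the average share of
  \<open>\<Sum>k. (P(A\<^sub>k) - \<phi>)\<^sub>+\<close>. Indices within a class are at least \<open>L + 1\<close> apart, so the event \<open>B\<close> that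
  no earlier event of the class occurs satisfies \<open>P(A\<^sub>k | B) \<ge> P(A\<^sub>k) - \<phi>\<close>. Multiplying
  these conditional bounds and using \<open>1 - x \<le> exp (-x)\<close> bounds the probability that no event of
  the class occurs.
\<close>

context prob_space
begin

section \<open>Mixing coefficients as bounded suprema\<close>

lemma cond_prob_set_eq:
  assumes "B \<in> events" "C \<in> events"
  shows "cond_prob M (\<lambda>\<omega>. \<omega> \<in> B) (\<lambda>\<omega>. \<omega> \<in> C) = prob (B \<inter> C) / prob C"
proof -
  have "{\<omega> \<in> space M. \<omega> \<in> B \<and> \<omega> \<in> C} = B \<inter> C" "{\<omega> \<in> space M. \<omega> \<in> C} = C"
    using assms[THEN sets.sets_into_space] by auto
  then show ?thesis by (simp add: cond_prob_def)
qed

lemma abs_cond_prob_diff_le_1: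
  assumes "B \<in> events" "C \<in> events"
  shows "\<bar>cond_prob M (\<lambda>\<omega>. \<omega> \<in> B) (\<lambda>\<omega>. \<omega> \<in> C) - prob B\<bar> \<le> 1"
proof -
  have "prob (B \<inter> C) / prob C \<le> 1"
    using assms by (simp add: divide_le_eq finite_measure_mono zero_less_measure_iff)
  moreover have "0 \<le> prob (B \<inter> C) / prob C" by simp
  ultimately show ?thesis
    using prob_le_1[of B] measure_nonneg[of M B] cond_prob_set_eq[OF assms] by linarith
qed

lemma abs_cond_prob_diff_le_phi_mix:
  assumes "\<A> \<subseteq> events" "\<B> \<subseteq> events" "C \<in> \<A>" "prob C > 0" "B \<in> \<B>"
  shows "\<bar>cond_prob M (\<lambda>\<omega>. \<omega> \<in> B) (\<lambda>\<omega>. \<omega> \<in> C) - prob B\<bar> \<le> phi_mix M \<A> \<B>"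
  unfolding phi_mix_def
proof (rule cSup_upper)
  show "bdd_above {\<bar>cond_prob M (\<lambda>\<omega>. \<omega> \<in> B) (\<lambda>\<omega>. \<omega> \<in> A) - prob B\<bar> | A B.
                     A \<in> \<A> \<and> prob A > 0 \<and> B \<in> \<B>}"
    using assms(1,2) by (intro bdd_aboveI[of _ 1]) (auto intro!: abs_cond_prob_diff_le_1)
qed (use assms in blast)

text \<open>This makes the outer supremum over \<open>k\<close> bounded above. The hypotheses on
  \<open>space M\<close> and \<open>\<B>\<close> keep the set under \<open>Sup\<close> nonempty,
  since \<open>cSup_least\<close> says nothing about an empty set of reals.\<close>

lemma phi_mix_le_1:
  assumes "\<A> \<subseteq> events" "\<B> \<subseteq> events" "space M \<in> \<A>" "\<B> \<noteq> {}"
  shows "phi_mix M \<A> \<B> \<le> 1"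
  unfolding phi_mix_def
proof (rule cSup_least)
  obtain B where "B \<in> \<B>" using assms(4) by blast
  moreover have "prob (space M) > 0" by (simp add: prob_space)
  ultimately show "{\<bar>cond_prob M (\<lambda>\<omega>. \<omega> \<in> B) (\<lambda>\<omega>. \<omega> \<in> A) - prob B\<bar> | A B.
          A \<in> \<A> \<and> prob A > 0 \<and> B \<in> \<B>} \<noteq> {}"
    using assms(3) by blast
qed (use assms(1,2) in \<open>auto intro!: abs_cond_prob_diff_le_1\<close>)

lemma events_sigma_subset_events:
  assumes "\<And>i. i \<in> I \<Longrightarrow> A i \<in> events"
  shows "events_sigma M A I \<subseteq> events"
  unfolding events_sigma_def using assms by (intro sets.sigma_sets_subset) auto

lemma space_in_events_sigma: "space M \<in> events_sigma M A I"
  unfolding events_sigma_def by (rule sigma_sets_top)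

text \<open>The index sets \<open>I k\<close>, \<open>J k\<close> and the range \<open>K\<close> are
  left general so that the suprema of both conventions are instances.\<close>

lemma phi_mix_events_sigma_le_SUP:
  fixes I J :: "'i \<Rightarrow> nat set"
  assumes "\<And>k i. k \<in> K \<Longrightarrow> i \<in> I k \<union> J k \<Longrightarrow> A i \<in> events" and "k \<in> K"
  shows "phi_mix M (events_sigma M A (I k)) (events_sigma M A (J k)) \<le>
           (SUP k\<in>K. phi_mix M (events_sigma M A (I k)) (events_sigma M A (J k)))"
proof (rule cSUP_upper[OF assms(2)], rule bdd_aboveI2)
  fix k assume "k \<in> K"
  then show "phi_mix M (events_sigma M A (I k)) (events_sigma M A (J k)) \<le> 1"
    using assms(1) space_in_events_sigma
    by (intro phi_mix_le_1 events_sigma_subset_events) blast+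
qed

text \<open>The pair consisting of \<open>space M\<close> twice always competes in the supremum and
  contributes the value 0.\<close>

lemma phi_mix_events_sigma_nonneg:
  assumes "\<And>i. i \<in> I \<union> J \<Longrightarrow> A i \<in> events"
  shows "0 \<le> phi_mix M (events_sigma M A I) (events_sigma M A J)"
proof -
  have "\<bar>cond_prob M (\<lambda>\<omega>. \<omega> \<in> space M) (\<lambda>\<omega>. \<omega> \<in> space M) - prob (space M)\<bar>
          \<le> phi_mix M (events_sigma M A I) (events_sigma M A J)"
    using assms
    by (intro abs_cond_prob_diff_le_phi_mix events_sigma_subset_events space_in_events_sigma)
      (auto simp: prob_space)
  then show ?thesis by linarith
qed

text \<open>The conditional bound is multiplied out so that it also covers a null event
  \<open>C\<close>, where the left side is zero. The constant \<open>c\<close> may be any upper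
  bound of the coefficient, in particular a supremum over \<open>k\<close>.\<close>

lemma prob_Int_ge_phi_mix:
  assumes "\<A> \<subseteq> events" "\<B> \<subseteq> events" "C \<in> \<A>" "B \<in> \<B>" "phi_mix M \<A> \<B> \<le> c"
  shows "prob C * (prob B - c) \<le> prob (C \<inter> B)"
proof (cases "prob C > 0")
  case True
  have "\<bar>cond_prob M (\<lambda>\<omega>. \<omega> \<in> B) (\<lambda>\<omega>. \<omega> \<in> C) - prob B\<bar> \<le> c"
    using abs_cond_prob_diff_le_phi_mix[OF assms(1-3) True assms(4)] assms(5) by linarith
  moreover have "cond_prob M (\<lambda>\<omega>. \<omega> \<in> B) (\<lambda>\<omega>. \<omega> \<in> C) = prob (B \<inter> C) / prob C"
    using assms by (intro cond_prob_set_eq) auto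
  ultimately have "prob B - c \<le> prob (B \<inter> C) / prob C" by linarith
  then show ?thesis using True by (simp add: field_simps Int_commute)
next
  case False
  then have "prob C = 0" using measure_nonneg[of M C] by linarith
  then show ?thesis by simp
qed

section \<open>Avoiding a separated family of events\<close>

text \<open>Induction that adds the largest index \<open>j\<close> last: avoidance of the smaller
  indices is an event of the past up to \<open>j - m\<close>, so passing to \<open>j\<close> costs a
  factor of at most \<open>1 - d\<close>. The hypothesis \<open>mixing\<close> is all that is used
  of the coefficient, which keeps the argument independent of the convention.\<close>

lemma prob_avoid_separated_le:
  fixes m N :: nat and c :: real
  assumes events: "\<And>k. k \<in> {1..N} \<Longrightarrow> A k \<in> events" and "0 \<le> c"
    and mixing: "\<And>k B. k \<ge> 1 \<Longrightarrow> k + m \<le> N \<Longrightarrow> B \<in> events_sigma M A {1..k} \<Longrightarrow>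
      prob B * (prob (A (k + m)) - c) \<le> prob (B \<inter> A (k + m))"
    and "finite I" "I \<subseteq> {1..N}" "\<And>i j. i \<in> I \<Longrightarrow> j \<in> I \<Longrightarrow> i < j \<Longrightarrow> i + m \<le> j"
  shows "prob (space M - (\<Union>i\<in>I. A i)) \<le> exp (- (\<Sum>i\<in>I. max (prob (A i) - c) 0))"
  using assms(4-6)
proof (induction I rule: finite_linorder_max_induct)
  case empty
  then show ?case by (simp add: prob_space)
next
  case (insert j I)
  define B where "B = space M - (\<Union>i\<in>I. A i)"
  define d where "d = max (prob (A j) - c) 0"
  have j: "j \<in> {1..N}" and I: "I \<subseteq> {1..N}" using insert.prems by auto
  have gap: "i + m \<le> j" if "i \<in> I" for i
    using insert.prems(2)[of i j] insert.hyps(2) that by auto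
  have IH: "prob B \<le> exp (- (\<Sum>i\<in>I. max (prob (A i) - c) 0))"
    unfolding B_def using insert.prems by (intro insert.IH) auto
  have B: "B \<in> events"
    unfolding B_def using I insert.hyps(1) events by (intro sets.Diff sets.finite_UN) auto
  have ge: "prob B * (prob (A j) - c) \<le> prob (B \<inter> A j)"
  \<comment> \<open>For empty \<open>I\<close> the index \<open>j\<close> can be at most
    \<open>m\<close>, so that no past up to \<open>j - m\<close> exists; there \<open>B\<close> is
    the whole space and \<open>0 \<le> c\<close> suffices.\<close>
  proof (cases "I = {}")
    case True
    then have "B = space M" by (simp add: B_def)
    then show ?thesis
      using assms(2) events[OF j] by (simp add: prob_space)
  next
    case False
    then obtain i where "i \<in> I" by blast
    \<comment> \<open>Any \<open>i\<close> in \<open>I\<close> satisfies \<open>1 \<le> i\<close>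
      and \<open>i + m \<le> j\<close>, so the natural-number subtraction does not truncate.\<close>
    then have "1 \<le> j - m" "j - m + m = j" using gap[of i] subsetD[OF I, of i] by auto
    moreover have "B \<in> events_sigma M A {1..j - m}"
    proof -
      have "A i \<in> sigma_sets (space M) (A ` {1..j - m})" if "i \<in> I" for i
        using gap[OF that] I that by (intro sigma_sets.Basic imageI) force
      moreover have "A ` {1..j - m} \<subseteq> Pow (space M)"
        using events[THEN sets.sets_into_space] j by fastforce
      ultimately have "(\<Union>i\<in>I. A i) \<in> sigma_sets (space M) (A ` {1..j - m})"
        using sigma_algebra.countable_UN'[OF sigma_algebra_sigma_sets] insert.hyps(1)
        by (metis (no_types, lifting) countable_finite image_subset_iff)
      then show ?thesis
        unfolding B_def events_sigma_def by (rule sigma_sets.Compl)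
    qed
    ultimately show ?thesis using mixing[of "j - m" B] j by simp
  qed
  \<comment> \<open>Where the positive part cuts off, \<open>d\<close> is 0 and the claim is
    nonnegativity of the measure.\<close>
  have "prob B * d \<le> prob (B \<inter> A j)"
    using ge unfolding d_def by (simp add: max_def)
  moreover have "prob (B - A j) = prob B - prob (B \<inter> A j)"
    using B events[OF j] by (rule finite_measure_Diff')
  moreover have "space M - (\<Union>i\<in>insert j I. A i) = B - A j"
    by (auto simp: B_def)
  ultimately have "prob (space M - (\<Union>i\<in>insert j I. A i)) \<le> prob B * (1 - d)"
    by (simp add: algebra_simps)
  also have "\<dots> \<le> prob B * exp (- d)"
    using exp_ge_add_one_self[of "- d"] by (intro mult_left_mono) auto
  also have "\<dots> \<le> exp (- (\<Sum>i\<in>I. max (prob (A i) - c) 0)) * exp (- d)"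
    using IH by (intro mult_right_mono) auto
  also have "\<dots> = exp (- (\<Sum>i\<in>insert j I. max (prob (A i) - c) 0))"
    using insert.hyps by (subst sum.insert) (auto simp: d_def simp flip: exp_add)
  finally show ?case .
qed

end

section \<open>From one residue class to the whole union\<close>

text \<open>Pigeonhole: the \<open>m\<close> classes partition \<open>K\<close>, so if each sum were
  below the average, the total would be below itself.\<close>

lemma exists_residue_class_sum_ge_average:
  fixes d :: "nat \<Rightarrow> real"
  assumes "finite K" "m > 0"
  shows "\<exists>r. (\<Sum>k\<in>K. d k) / real m \<le> (\<Sum>k\<in>{k\<in>K. k mod m = r}. d k)"
proof (rule ccontr)
  assume "\<not> ?thesis"
  then have less: "(\<Sum>k\<in>{k\<in>K. k mod m = r}. d k) < (\<Sum>k\<in>K. d k) / real m" for r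
    by (simp add: not_le)
  have "(\<Sum>k\<in>K. d k) = (\<Sum>r<m. \<Sum>k\<in>{k\<in>K. k mod m = r}. d k)"
    using assms by (intro sum.group[symmetric]) auto
  also have "\<dots> < (\<Sum>r<m. (\<Sum>k\<in>K. d k) / real m)"
    using less assms by (intro sum_strict_mono) auto
  finally show False using assms by simp
qed

lemma (in prob_space) prob_Union_ge_of_mixing:
  fixes m N :: nat and c :: real
  assumes events: "\<And>k. k \<in> {1..N} \<Longrightarrow> A k \<in> events" and "0 \<le> c" and "m > 0"
    and mixing: "\<And>k B. k \<ge> 1 \<Longrightarrow> k + m \<le> N \<Longrightarrow> B \<in> events_sigma M A {1..k} \<Longrightarrow>
      prob B * (prob (A (k + m)) - c) \<le> prob (B \<inter> A (k + m))"
  shows "1 - exp (- (\<Sum>k=1..N. max (prob (A k) - c) 0) / real m) \<le> prob (\<Union>k\<in>{1..N}. A k)"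
proof -
  define d where "d k = max (prob (A k) - c) 0" for k
  obtain r where r: "(\<Sum>k=1..N. d k) / real m \<le> (\<Sum>k\<in>{k\<in>{1..N}. k mod m = r}. d k)"
    using exists_residue_class_sum_ge_average[of "{1..N}" m d] assms(3) by auto
  let ?I = "{k\<in>{1..N}. k mod m = r}"
  have gap: "i + m \<le> j" if "i \<in> ?I" "j \<in> ?I" "i < j" for i j
  proof -
    have "m dvd j - i" using that mod_eq_dvd_iff_nat[of i j m] by simp
    then show ?thesis using that dvd_imp_le[of m "j - i"] by linarith
  qed
  have Un: "(\<Union>k\<in>{1..N}. A k) \<in> events" using events by blast
  have "1 - prob (\<Union>k\<in>{1..N}. A k) = prob (space M - (\<Union>k\<in>{1..N}. A k))"
    using Un by (simp add: prob_compl)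
  \<comment> \<open>Avoiding all events entails avoiding those of the chosen class.\<close>
  also have "\<dots> \<le> prob (space M - (\<Union>k\<in>?I. A k))"
    using events by (intro finite_measure_mono) (auto intro!: sets.Diff sets.finite_UN)
  also have "\<dots> \<le> exp (- (\<Sum>k\<in>?I. d k))"
    unfolding d_def
    by (rule prob_avoid_separated_le[of N A c m ?I, OF events assms(2) mixing _ _ gap]) auto
  also have "\<dots> \<le> exp (- (\<Sum>k=1..N. d k) / real m)"
    using r by simp
  finally show ?thesis by (simp add: d_def)
qed

section \<open>Common treatment of the two conventions\<close>

lemma (in prob_space) phi_convention_mixing:
  fixes N m :: nat and \<phi> :: "nat \<Rightarrow> real"
  assumes "N \<ge> 1"
    and convention:
      "((\<forall>k\<ge>1. A k \<in> events) \<and> \<phi> = phi_ambient M A) \<or>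
       ((\<forall>k\<in>{1..N}. A k \<in> events) \<and> \<phi> = phi_restricted M A N)"
  shows phi_convention_nonneg: "0 \<le> \<phi> m"
    and phi_convention_prob_Int_ge:
      "\<And>k B. k \<ge> 1 \<Longrightarrow> k + m \<le> N \<Longrightarrow> B \<in> events_sigma M A {1..k} \<Longrightarrow>
        prob B * (prob (A (k + m)) - \<phi> m) \<le> prob (B \<inter> A (k + m))"
proof -
  \<comment> \<open>\<open>J k\<close> is the index set of the future after a gap \<open>m\<close>:
    \<open>{k + m..}\<close> in the ambient convention and \<open>{k + m..N}\<close> in the
    restricted one. These three facts are all that the rest uses, and the bound
    \<open>k + m \<le> N\<close> in the last one puts \<open>k + m\<close> into the restricted
    future.\<close>
  obtain J where J: "\<And>k i. k \<in> {1..N} \<Longrightarrow> i \<in> {1..k} \<union> J k \<Longrightarrow> A i \<in> events"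
    and le: "\<And>k. k \<in> {1..N} \<Longrightarrow>
      phi_mix M (events_sigma M A {1..k}) (events_sigma M A (J k)) \<le> \<phi> m"
    and mem: "\<And>k. k \<ge> 1 \<Longrightarrow> k + m \<le> N \<Longrightarrow> k + m \<in> J k"
    using convention
  proof (elim disjE conjE)
    assume A: "\<forall>k\<ge>1. A k \<in> events" and \<phi>: "\<phi> = phi_ambient M A"
    show thesis
    proof (rule that[of "\<lambda>k. {k + m..}"])
      show "phi_mix M (events_sigma M A {1..k}) (events_sigma M A {k + m..}) \<le> \<phi> m"
        if "k \<in> {1..N}" for k
        unfolding \<phi> phi_ambient_def using A that
        by (intro phi_mix_events_sigma_le_SUP[where I = "\<lambda>k. {1..k}" and J = "\<lambda>k. {k + m..}"]) auto
    qed (use A in auto)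
  next
    assume A: "\<forall>k\<in>{1..N}. A k \<in> events" and \<phi>: "\<phi> = phi_restricted M A N"
    show thesis
    proof (rule that[of "\<lambda>k. {k + m..N}"])
      show "phi_mix M (events_sigma M A {1..k}) (events_sigma M A {k + m..N}) \<le> \<phi> m"
        if "k \<in> {1..N}" for k
        unfolding \<phi> phi_restricted_def using A that
        by (intro phi_mix_events_sigma_le_SUP[where I = "\<lambda>k. {1..k}" and J = "\<lambda>k. {k + m..N}"]) auto
    qed (use A in auto)
  qed
  \<comment> \<open>\<open>k = 1\<close> is an admissible index because \<open>N \<ge> 1\<close>;
    one nonnegative member makes the supremum nonnegative.\<close>
  have "0 \<le> phi_mix M (events_sigma M A {1..1}) (events_sigma M A (J 1))"
    using J[of 1] assms(1) by (intro phi_mix_events_sigma_nonneg) auto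
  also have "\<dots> \<le> \<phi> m" using le[of 1] assms(1) by simp
  finally show "0 \<le> \<phi> m" .
  fix k B assume k: "k \<ge> 1" "k + m \<le> N" and B: "B \<in> events_sigma M A {1..k}"
  have kN: "k \<in> {1..N}" using k by simp
  show "prob B * (prob (A (k + m)) - \<phi> m) \<le> prob (B \<inter> A (k + m))"
  proof (rule prob_Int_ge_phi_mix[OF _ _ B _ le[OF kN]])
    show "events_sigma M A {1..k} \<subseteq> events" "events_sigma M A (J k) \<subseteq> events"
      using J[OF kN] by (intro events_sigma_subset_events; blast)+
    show "A (k + m) \<in> events_sigma M A (J k)"
      unfolding events_sigma_def using mem[OF k] by (intro sigma_sets.Basic imageI)
  qed
qed

theorem theorem3p1:
  fixes M :: "'a measure" and A :: "nat \<Rightarrow> 'a set" and N L :: nat and \<phi> :: "nat \<Rightarrow> real"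
  assumes "prob_space M"
    and "N \<ge> 1"
    and convention:
      "((\<forall>k\<ge>1. A k \<in> sets M) \<and> \<phi> = phi_ambient M A) \<or>
       ((\<forall>k\<in>{1..N}. A k \<in> sets M) \<and> \<phi> = phi_restricted M A N)"
  shows "measure M (\<Union>k\<in>{1..N}. A k) \<ge>
           1 - exp (- (1 / (real L + 1)) * (\<Sum>k=1..N. max (measure M (A k) - \<phi> (L + 1)) 0)) \<and>
         (\<phi> (L + 1) \<le> (MIN k\<in>{1..N}. measure M (A k)) \<longrightarrow>
          measure M (\<Union>k\<in>{1..N}. A k) \<ge>
            1 - exp (- (1 / (real L + 1)) * ((\<Sum>k=1..N. measure M (A k)) - real N * \<phi> (L + 1))))"
proof -
  interpret prob_space M by fact
  have events: "A k \<in> events" if "k \<in> {1..N}" for k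
    using convention that by auto
  have main: "measure M (\<Union>k\<in>{1..N}. A k) \<ge>
      1 - exp (- (1 / (real L + 1)) * (\<Sum>k=1..N. max (measure M (A k) - \<phi> (L + 1)) 0))"
    \<comment> \<open>The gap and the modulus are both \<open>L + 1\<close>, which accounts for the
      argument of \<open>\<phi>\<close> and for the factor \<open>1 / (real L + 1)\<close>.\<close>
    using prob_Union_ge_of_mixing[of N A "\<phi> (L + 1)" "L + 1", OF events
        phi_convention_nonneg[OF assms(2) convention] _
        phi_convention_prob_Int_ge[OF assms(2) convention]]
    by (simp add: add.commute)
  \<comment> \<open>Below the minimum of the probabilities no positive part cuts anything off, so
    the sum splits linearly.\<close>
  moreover have "(\<Sum>k=1..N. max (measure M (A k) - \<phi> (L + 1)) 0) =
      (\<Sum>k=1..N. measure M (A k)) - real N * \<phi> (L + 1)"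
    if le: "\<phi> (L + 1) \<le> (MIN k\<in>{1..N}. measure M (A k))"
  proof -
    have "\<phi> (L + 1) \<le> measure M (A k)" if "k \<in> {1..N}" for k
      using le that by (intro order.trans[OF le] Min_le) auto
    then have "(\<Sum>k=1..N. max (measure M (A k) - \<phi> (L + 1)) 0) =
        (\<Sum>k=1..N. measure M (A k) - \<phi> (L + 1))"
      by (intro sum.cong) (simp_all add: max_absorb1)
    then show ?thesis by (simp add: sum_subtractf)
  qed
  ultimately show ?thesis by metis
qed

end
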